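(* Fix a slot $t$. Suppose that for every node $i\in\{1,\dots,N\}$ the predictive CDF $F_{i,t}(\cdot)$ is continuous and the cloud-activation threshold $\rho\mapsto\theta_{c,i}(t,\rho)$ is continuous on $[0,1]$. Then the equation $$\rho=\frac1N\sum_{i=1}^N\Big[1-F_{i,t}\big(\theta_{c,i}(t,\rho)\big)\Big]$$ has at least one solution $\rho\in[0,1]$. If, in addition, the induced map $\mathcal{T}_t:[0,1]\to\mathbb{R}$, $\mathcal{T}_t(\rho)=\frac1N\sum_{i=1}^N[1-F_{i,t}(\theta_{c,i}(t,\rho))]$, is a contraction (Lipschitz with constant strictly less than $1$), then the solution in $[0,1]$ is unique.
   Context: There are $N\ge 1$ nodes. $F_{i,t}$ is the cumulative distribution function of a probability distribution on $[0,1]$ (the predictive law of the routing score of node $i$ at slot $t$), with $F_{i,t}(+\infty)=1$. The cloud-activation threshold is $$\theta_{c,i}(t,\rho)=\inf\Big\{r\in[0,1]:\ J^{(2)}_{i,t}(r,\rho)\le\min\{J^{(0)}_{i,t},\,J^{(1)}_{i,t}(r)\}\Big\},\qquad \inf\emptyset=+\infty,$$ (continuity is understood as that of a map into $[0,+\infty]$), where $$J^{(0)}_{i,t}=0,\qquad J^{(1)}_{i,t}(r)=\frac{\kappa^{(1)}_{i,t}}{V}-G_{1,i}(r),\qquad J^{(2)}_{i,t}(r,\rho)=\frac{\kappa^{(1)}_{i,t}+\kappa^{(2)}_{i,t}(\rho)}{V}-G_{1,i}(r)-G_{2,i}(r),$$ $$\kappa^{(1)}_{i,t}=Q_\tau(t)\big(\tau_i^{(1)}-\tau_i^{(0)}\big),\qquad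 \kappa^{(2)}_{i,t}(\rho)=Q_\tau(t)\big(\tau_i^{(2)}(\rho)-\tau_i^{(1)}\big)+Q_c(t)\kappa_i+Q_\rho(t).$$ Here $V>0$; $Q_\tau(t),Q_c(t),Q_\rho(t)\ge0$ are fixed queue values; $\tau_i^{(0)},\tau_i^{(1)},\kappa_i\ge0$ are constants; $\tau_i^{(2)}:[0,1]\to[0,\infty)$ is the load-dependent latency of the cloud mode; and $G_{1,i},G_{2,i}:[0,1]\to\mathbb{R}$ are continuous nondecreasing gain functions. *)

theory Defs
  imports "HOL-Probability.Probability"
begin

text \<open>Nodes and slots are indexed by natural numbers; the nodes are \<open>1, \<dots>, N\<close>.\<close>

record routing_system =
  nodes :: nat                                      (* N *)
  pen :: real                                       (* V *)
  Q_tau :: "nat \<Rightarrow> real"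
  Q_c :: "nat \<Rightarrow> real"
  Q_rho :: "nat \<Rightarrow> real"
  tau0 :: "nat \<Rightarrow> real"
  tau1 :: "nat \<Rightarrow> real"
  tau2 :: "nat \<Rightarrow> real \<Rightarrow> real"
  cost :: "nat \<Rightarrow> real"                             (* the constants kappa_i *)
  gain1 :: "nat \<Rightarrow> real \<Rightarrow> real"
  gain2 :: "nat \<Rightarrow> real \<Rightarrow> real"
  law :: "nat \<Rightarrow> nat \<Rightarrow> real measure"               (* node i, slot t; its CDF is F_{i,t} *)

text \<open>The standing assumptions at slot \<open>t\<close>. The functions \<open>tau2\<close>, \<open>gain1\<close>, \<open>gain2\<close> live on
  \<open>[0,1]\<close>, so nothing is required of them elsewhere.\<close>

definition admissible :: "routing_system \<Rightarrow> nat \<Rightarrow> bool" where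
  "admissible S t \<longleftrightarrow>
     nodes S \<ge> 1 \<and> pen S > 0 \<and> Q_tau S t \<ge> 0 \<and> Q_c S t \<ge> 0 \<and> Q_rho S t \<ge> 0 \<and>
     (\<forall>i\<in>{1..nodes S}.
        tau0 S i \<ge> 0 \<and> tau1 S i \<ge> 0 \<and> cost S i \<ge> 0 \<and>
        (\<forall>\<rho>\<in>{0..1}. tau2 S i \<rho> \<ge> 0) \<and>
        continuous_on {0..1} (gain1 S i) \<and> mono_on {0..1} (gain1 S i) \<and>
        continuous_on {0..1} (gain2 S i) \<and> mono_on {0..1} (gain2 S i) \<and>
        real_distribution (law S i t) \<and> measure (law S i t) {0..1} = 1)"

definition kappa1 :: "routing_system \<Rightarrow> nat \<Rightarrow> nat \<Rightarrow> real" where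
  "kappa1 S i t = Q_tau S t * (tau1 S i - tau0 S i)"

definition kappa2 :: "routing_system \<Rightarrow> nat \<Rightarrow> nat \<Rightarrow> real \<Rightarrow> real" where
  "kappa2 S i t \<rho> = Q_tau S t * (tau2 S i \<rho> - tau1 S i) + Q_c S t * cost S i + Q_rho S t"

definition J0 :: "routing_system \<Rightarrow> nat \<Rightarrow> nat \<Rightarrow> real" where
  "J0 S i t = 0"

definition J1 :: "routing_system \<Rightarrow> nat \<Rightarrow> nat \<Rightarrow> real \<Rightarrow> real" where
  "J1 S i t r = kappa1 S i t / pen S - gain1 S i r"

definition J2 :: "routing_system \<Rightarrow> nat \<Rightarrow> nat \<Rightarrow> real \<Rightarrow> real \<Rightarrow> real" where
  "J2 S i t r \<rho> = (kappa1 S i t + kappa2 S i t \<rho>) / pen S - gain1 S i r - gain2 S i r"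

text \<open>The infimum is taken in \<^typ>\<open>ereal\<close>, where the infimum of the empty set is \<open>\<infinity>\<close>.\<close>

definition theta_c :: "routing_system \<Rightarrow> nat \<Rightarrow> nat \<Rightarrow> real \<Rightarrow> ereal" where
  "theta_c S i t \<rho> = Inf (ereal ` {r \<in> {0..1}. J2 S i t r \<rho> \<le> min (J0 S i t) (J1 S i t r)})"

definition ecdf :: "real measure \<Rightarrow> ereal \<Rightarrow> real" where
  "ecdf M x = (case x of ereal r \<Rightarrow> cdf M r | PInfty \<Rightarrow> 1 | MInfty \<Rightarrow> 0)"

definition load_map :: "routing_system \<Rightarrow> nat \<Rightarrow> real \<Rightarrow> real" where
  "load_map S t \<rho> =
     1 / real (nodes S) * (\<Sum>i=1..nodes S. 1 - ecdf (law S i t) (theta_c S i t \<rho>))"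

end

theory Submission imports Defs begin

text \<open>The load map is an average of probabilities, so it sends [0,1] into itself
  (\<open>load_map_bounds\<close>). Thresholds may equal \<infinity>, but a CDF tends to 1 there, so
  a continuous CDF stays continuous when extended to the extended reals
  (\<open>isCont_ecdf\<close>); composing with the thresholds makes the load map continuous.
  Existence is then Brouwer in dimension one, that is, the intermediate value theorem. The
  contraction hypothesis serves only for uniqueness.\<close>

lemma (in real_distribution) ecdf_bounds: "0 \<le> ecdf M x" "ecdf M x \<le> 1"
  by (cases x; simp add: ecdf_def cdf_nonneg cdf_bounded_prob)+

text \<open>At finite points this is the hypothesis; at the two infinite points it is the limits 1
  and 0 of a CDF, which are the values \<open>ecdf\<close> takes there.\<close>

lemma (in real_distribution) isCont_ecdf:
  assumes "continuous_on UNIV (cdf M)"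
  shows "isCont (ecdf M) x"
proof (cases x)
  case (real r)
  have "cdf M \<midarrow>r\<rightarrow> cdf M r"
    using assms by (simp add: continuous_on_eq_continuous_at isCont_def)
  then show ?thesis
    unfolding real isCont_def unfolding at_ereal filterlim_filtermap by (simp add: ecdf_def)
next
  case PInf
  have "(ecdf M \<longlongrightarrow> 1) (at_left \<infinity>)"
    unfolding at_left_PInf filterlim_filtermap
    using cdf_lim_at_top_prob by (simp add: ecdf_def)
  \<comment> \<open>Nothing lies above \<infinity>, so its punctured neighbourhoods are
    one-sided.\<close>
  moreover have "at (\<infinity>::ereal) = at_left \<infinity>"
    unfolding at_within_def by (rule arg_cong[where f = "\<lambda>A. inf _ (principal A)"]) auto
  moreover have "ecdf M \<infinity> = 1"
    unfolding ecdf_def PInfty_eq_infinity[symmetric] ereal.case ..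
  ultimately show ?thesis
    unfolding PInf isCont_def by simp
next
  case MInf
  have "(ecdf M \<longlongrightarrow> 0) (at_right (-\<infinity>))"
    unfolding at_right_MInf filterlim_filtermap
    using cdf_lim_at_bot by (simp add: ecdf_def)
  moreover have "at (-\<infinity>::ereal) = at_right (-\<infinity>)"
    unfolding at_within_def by (rule arg_cong[where f = "\<lambda>A. inf _ (principal A)"]) auto
  moreover have "ecdf M (-\<infinity>) = 0"
    unfolding ecdf_def MInfty_eq_minfinity[symmetric] ereal.case ..
  ultimately show ?thesis
    unfolding MInf isCont_def by simp
qed

lemma load_map_bounds:
  assumes "admissible S t"
  shows "load_map S t \<rho> \<in> {0..1}"
proof -
  define s where "s = (\<Sum>i=1..nodes S. 1 - ecdf (law S i t) (theta_c S i t \<rho>))"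
  have dist: "real_distribution (law S i t)" if "i \<in> {1..nodes S}" for i
    using assms that by (auto simp: admissible_def)
  have "0 \<le> s"
    unfolding s_def by (intro sum_nonneg) (simp add: dist real_distribution.ecdf_bounds)
  moreover have "s \<le> real (card {1..nodes S}) * 1"
    unfolding s_def by (intro sum_bounded_above) (simp add: dist real_distribution.ecdf_bounds)
  moreover have "load_map S t \<rho> = s / real (nodes S)" "nodes S \<ge> 1"
    using assms by (auto simp: load_map_def s_def admissible_def)
  ultimately show ?thesis
    by (simp add: divide_le_eq)
qed

text \<open>Continuity of \<open>ecdf\<close> on all of \<open>ereal\<close> is what lets a
  threshold pass continuously between finite values and \<infinity>.\<close>

lemma continuous_on_load_map:
  assumes "admissible S t"
    and "\<And>i. i \<in> {1..nodes S} \<Longrightarrow> continuous_on UNIV (cdf (law S i t))"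
    and "\<And>i. i \<in> {1..nodes S} \<Longrightarrow> continuous_on A (theta_c S i t)"
  shows "continuous_on A (load_map S t)"
proof -
  have "continuous_on A (\<lambda>\<rho>. ecdf (law S i t) (theta_c S i t \<rho>))"
    if i: "i \<in> {1..nodes S}" for i
  proof -
    interpret real_distribution "law S i t"
      using assms(1) i by (auto simp: admissible_def)
    have "continuous_on UNIV (ecdf (law S i t))"
      using isCont_ecdf[OF assms(2)[OF i]] by (simp add: continuous_on_eq_continuous_at)
    from continuous_on_compose2[OF this assms(3)[OF i]] show ?thesis by simp
  qed
  then show ?thesis
    unfolding load_map_def by (intro continuous_intros) auto
qed

lemma unit_interval_fixpoint:
  fixes f :: "real \<Rightarrow> real"
  assumes "continuous_on {0..1} f" "f ` {0..1} \<subseteq> {0..1}"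
  shows "\<exists>x\<in>{0..1}. x = f x"
proof -
  \<comment> \<open>The function \<open>x - f x\<close> is at most 0 at 0 and at least 0 at 1,
    because \<open>f\<close> stays in the unit interval.\<close>
  have "\<exists>x\<ge>0. x \<le> 1 \<and> x - f x = 0"
    using assms by (intro IVT' continuous_intros) (auto simp: image_subset_iff)
  then obtain x where "0 \<le> x" "x \<le> 1" "x - f x = 0" by blast
  then show ?thesis by (intro bexI[of _ x]) simp_all
qed

text \<open>Two distinct fixed points would keep their positive distance under \<open>f\<close>,
  while \<open>f\<close> shrinks it strictly.\<close>

lemma lipschitz_contraction_fixpoint_unique:
  fixes f :: "'a::metric_space \<Rightarrow> 'a"
  assumes "L-lipschitz_on A f" "L < 1" "x \<in> A" "y \<in> A" "x = f x" "y = f y"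
  shows "x = y"
proof (rule ccontr)
  assume "x \<noteq> y"
  have "dist x y \<le> L * dist x y"
    using lipschitz_onD[OF assms(1,3,4)] by (simp flip: assms(5,6))
  also have "\<dots> < dist x y"
    using \<open>x \<noteq> y\<close> \<open>L < 1\<close> by simp
  finally show False by simp
qed

theorem mainTheorem2:
  fixes S :: routing_system and t :: nat
  assumes "admissible S t"
    and "\<And>i. i \<in> {1..nodes S} \<Longrightarrow> continuous_on UNIV (cdf (law S i t))"
    and "\<And>i. i \<in> {1..nodes S} \<Longrightarrow> continuous_on {0..1} (theta_c S i t)"
  shows "(\<exists>\<rho>\<in>{0..1}. \<rho> = load_map S t \<rho>) \<and>
    ((\<exists>L<1. L-lipschitz_on {0..1} (load_map S t)) \<longrightarrow>
      (\<exists>!\<rho>. \<rho> \<in> {0..1} \<and> \<rho> = load_map S t \<rho>))"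
proof -
  have "\<exists>\<rho>\<in>{0..1}. \<rho> = load_map S t \<rho>"
    using continuous_on_load_map[OF assms] load_map_bounds[OF assms(1)]
    by (intro unit_interval_fixpoint) auto
  then show ?thesis
    by (meson lipschitz_contraction_fixpoint_unique)
qed

end
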